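(* Let $T_1$ and $T_2$ be trees of orders $m,n$ and diameters $d_1,d_2$, respectively, with $|W(T_1)|=|W(T_2)|=2$. Let $G=T_1\Box T_2$, $p=mn$, $d=d_1+d_2$. If ${\rm rn}(G)=(p-1)(d-1)-2nL(T_1)-2mL(T_2)+1$, then $T_1=T_2=P_2$.
   Context: All graphs are finite, simple and connected; $d(u,v)$ is the distance and ${\rm diam}(G)$ the diameter. A radio labeling of $G$ is a map $f:V(G)\to\mathbb{Z}_{\ge 0}$ with $|f(u)-f(v)|\geq {\rm diam}(G)+1-d(u,v)$ for all distinct $u,v$; its span is $\max f-\min f$, and ${\rm rn}(G)$ is the minimum span. For a tree $T$ and $v\in V(T)$, $w_T(v)=\sum_{u}d(u,v)$; weight centers are the minimizers of $w_T$ and $W(T)$ is their set. The level of $u$ is $L_T(u)=\min_{w\in W(T)}d(u,w)$ and $L(T)=\sum_{u\in V(T)}L_T(u)$. $T_1\Box T_2$ is the Cartesian product; $P_2$ is the path on two vertices. *)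

theory Defs
  imports "Graph_Theory.Graph_Theory"
begin

text \<open>
  Finite simple graphs are represented by the locale \<open>pair_graph\<close>: finite, loop-free digraphs
  without parallel arcs whose arc relation is symmetric, so that an undirected edge \<open>{u, v}\<close>
  is the pair of arcs \<open>(u, v)\<close>, \<open>(v, u)\<close>.
\<close>

text \<open>
  The constant \<open>Digraph_Component.tree\<close> is not usable for symmetric digraphs: there every
  edge gives the directed cycle \<open>u, v, u\<close>. The cycles of the undirected graph are the
  directed cycles with at least three arcs.
\<close>

definition undirected_tree :: "'a pair_pre_digraph \<Rightarrow> bool" where
  "undirected_tree T \<longleftrightarrow>
     pair_graph T \<and> Digraph_Component.connected (with_proj T) \<and>
     \<not> (\<exists>p. pre_digraph.cycle (with_proj T) p \<and> 3 \<le> length p)"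

text \<open>The number of arcs of a shortest walk; only meaningful if \<open>v\<close> is reachable from \<open>u\<close>.\<close>

definition gdist :: "'a pair_pre_digraph \<Rightarrow> 'a \<Rightarrow> 'a \<Rightarrow> nat" where
  "gdist G u v = (LEAST k. \<exists>p. pre_digraph.awalk (with_proj G) u p v \<and> length p = k)"

definition diam :: "'a pair_pre_digraph \<Rightarrow> nat" where
  "diam G = Max {gdist G u v | u v. u \<in> pverts G \<and> v \<in> pverts G}"

definition radio_labeling :: "'a pair_pre_digraph \<Rightarrow> ('a \<Rightarrow> nat) \<Rightarrow> bool" where
  "radio_labeling G f \<longleftrightarrow>
     (\<forall>u \<in> pverts G. \<forall>v \<in> pverts G. u \<noteq> v \<longrightarrow>
        \<bar>int (f u) - int (f v)\<bar> \<ge> int (diam G) + 1 - int (gdist G u v))"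

definition label_span :: "'a pair_pre_digraph \<Rightarrow> ('a \<Rightarrow> nat) \<Rightarrow> nat" where
  "label_span G f = Max (f ` pverts G) - Min (f ` pverts G)"

definition radio_number :: "'a pair_pre_digraph \<Rightarrow> nat" where
  "radio_number G = (LEAST k. \<exists>f. radio_labeling G f \<and> label_span G f = k)"

definition vertex_weight :: "'a pair_pre_digraph \<Rightarrow> 'a \<Rightarrow> nat" where
  "vertex_weight T v = (\<Sum>u \<in> pverts T. gdist T u v)"

definition weight_centers :: "'a pair_pre_digraph \<Rightarrow> 'a set" where
  "weight_centers T =
     {v \<in> pverts T. \<forall>u \<in> pverts T. vertex_weight T v \<le> vertex_weight T u}"

definition vertex_level :: "'a pair_pre_digraph \<Rightarrow> 'a \<Rightarrow> nat" where
  "vertex_level T u = Min (gdist T u ` weight_centers T)"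

definition total_level :: "'a pair_pre_digraph \<Rightarrow> nat" where
  "total_level T = (\<Sum>u \<in> pverts T. vertex_level T u)"

definition cartesian_product ::
    "'a pair_pre_digraph \<Rightarrow> 'b pair_pre_digraph \<Rightarrow> ('a \<times> 'b) pair_pre_digraph"
    (infixr \<open>\<box>\<close> 80) where
  "G \<box> H = \<lparr> pverts = pverts G \<times> pverts H,
     parcs = {((a, b), (c, d)). (a = c \<and> a \<in> pverts G \<and> (b, d) \<in> parcs H) \<or>
                                ((a, c) \<in> parcs G \<and> b = d \<and> b \<in> pverts H)} \<rparr>"

text \<open>The path on \<open>k\<close> vertices.\<close>

definition path_graph :: "nat \<Rightarrow> nat pair_pre_digraph" where
  "path_graph k = \<lparr> pverts = {..<k},
     parcs = {(i, j). i < k \<and> j < k \<and> (j = Suc i \<or> i = Suc j)} \<rparr>"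

end

theory Submission
  imports Defs
begin

text \<open>
  List the vertices \<open>x\<^sub>0, ..., x\<^sub>q\<close> of the product by increasing label. The weight is strictly
  convex along the paths of a tree, so the two weight centers are adjacent. Assigning each vertex
  to the nearer center halves each tree and cuts the product into quarters; the triangle
  inequality through the centers gives \<open>d(u,v) \<le> L(u) + L(v) + c(u,v)\<close>, where \<open>c(u,v)\<close> counts the
  coordinates in which the halves of \<open>u\<close> and \<open>v\<close> differ. Summing the radio condition over consecutive
  vertices, the hypothesis on the span leaves a total slack of \<open>1\<close>. A step with \<open>c = 2\<close> never
  leaves a diagonal pair of quarters, so some step \<open>x\<^sub>t, x\<^sub>t\<^sub>+\<^sub>1\<close> has \<open>c = 1\<close> and uses up the slack;
  all other steps are tight and both ends have level \<open>0\<close>. The radio condition for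
  \<open>x\<^sub>i\<^sub>-\<^sub>1, x\<^sub>i\<^sub>+\<^sub>1\<close> then bounds \<open>2 L(x\<^sub>i)\<close> by \<open>d - 3\<close>, or by \<open>d - 1\<close> if \<open>i\<close> is \<open>t\<close> or \<open>t + 1\<close>. Since
  \<open>d \<le> 2 max L + 2\<close>, vertices of maximal level occur only at \<open>t\<close> and \<open>t + 1\<close>, but there are at
  least three of them unless all levels vanish.
\<close>

section \<open>Distances in connected graphs and their products\<close>

context pair_wf_digraph
begin

text \<open>Relational powers handle concatenation, reversal and projection of walks more easily
  than arc lists. The case \<open>k = 0\<close> requires \<open>u\<close> to be a vertex, since the
  empty arc list is a walk only at a vertex.\<close>

lemma awalk_relpow:
  assumes "u \<in> pverts G"
  shows "(\<exists>p. awalk u p v \<and> length p = k) \<longleftrightarrow> (u, v) \<in> parcs G ^^ k"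
  using assms
proof (induction k arbitrary: u)
  case 0
  then show ?case by (auto simp: awalk_Nil_iff)
next
  case (Suc k)
  show ?case
  proof
    assume "\<exists>p. awalk u p v \<and> length p = Suc k"
    then obtain e q where "awalk u (e # q) v" "length q = k"
      by (metis length_Suc_conv)
    then have "(u, snd e) \<in> parcs G" "awalk (snd e) q v"
      by (auto simp: awalk_Cons_iff)
    moreover from this have "(snd e, v) \<in> parcs G ^^ k"
      using Suc.IH[of "snd e"] \<open>length q = k\<close> in_arcsD2 by blast
    ultimately show "(u, v) \<in> parcs G ^^ Suc k"
      by (meson relpow_Suc_I2)
  next
    assume "(u, v) \<in> parcs G ^^ Suc k"
    then obtain w where w: "(u, w) \<in> parcs G" "(w, v) \<in> parcs G ^^ k"
      by (meson relpow_Suc_E2)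
    with Suc.IH[of w] in_arcsD2 obtain q where "awalk w q v" "length q = k"
      by blast
    with w(1) in_arcsD1 have "awalk u ((u, w) # q) v" "length ((u, w) # q) = Suc k"
      by (auto simp: awalk_Cons_iff)
    then show "\<exists>p. awalk u p v \<and> length p = Suc k" by blast
  qed
qed

lemma gdist_eq_Least_relpow:
  "u \<in> pverts G \<Longrightarrow> gdist G u v = (LEAST k. (u, v) \<in> parcs G ^^ k)"
  by (simp add: gdist_def awalk_relpow)

lemma gdist_le_length: "awalk u p v \<Longrightarrow> gdist G u v \<le> length p"
  unfolding gdist_def by (rule Least_le) blast

end

lemma sym_relpow:
  assumes "sym R" shows "(x, y) \<in> R ^^ k \<Longrightarrow> (y, x) \<in> R ^^ k"
proof (induction k arbitrary: y)
  case (Suc k)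
  then obtain z where "(x, z) \<in> R ^^ k" "(z, y) \<in> R" by auto
  with Suc.IH assms show ?case by (meson relpow_Suc_I2 symE)
qed simp

locale connected_pair_graph = pair_graph +
  assumes connected: "Digraph_Component.connected (with_proj G)"
begin

abbreviation dist :: "'a \<Rightarrow> 'a \<Rightarrow> nat" where
  "dist \<equiv> gdist G"

lemma sym_parcs: "sym (parcs G)"
  using pair_sym_arcs by (simp add: symmetric_def)

lemma pverts_nonempty: "pverts G \<noteq> {}"
  using connected by (auto simp: connected_def strongly_connected_def mk_symmetric_def)

lemma shortest_awalk:
  assumes "u \<in> pverts G" "v \<in> pverts G"
  obtains p where "awalk u p v" "length p = dist u v"
proof -
  \<comment> \<open>Connectedness is reachability in the symmetric closure, which adds no arcs
    here.\<close>
  have "parcs (mk_symmetric (with_proj G)) = parcs G"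
    using sym_parcs by (auto simp: mk_symmetric_def sym_def)
  then have "with_proj (mk_symmetric (with_proj G)) = with_proj G"
    by (simp add: with_proj_def mk_symmetric_def)
  with connected assms have "reachable (with_proj G) u v"
    by (auto simp: connected_def strongly_connected_def)
  then obtain p where "awalk u p v" by (auto simp: reachable_awalk)
  then have "\<exists>k p. awalk u p v \<and> length p = k" by blast
  then have "\<exists>p. awalk u p v \<and> length p = dist u v"
    unfolding gdist_def by (rule LeastI_ex)
  with that show thesis by blast
qed

lemma dist_relpow:
  assumes "u \<in> pverts G" "v \<in> pverts G"
  shows "(u, v) \<in> parcs G ^^ dist u v"
  using shortest_awalk[OF assms] awalk_relpow[OF assms(1)] by blast

lemma dist_le_relpow: "u \<in> pverts G \<Longrightarrow> (u, v) \<in> parcs G ^^ k \<Longrightarrow> dist u v \<le> k"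
  by (simp add: gdist_eq_Least_relpow Least_le)

lemma dist_commute:
  assumes "u \<in> pverts G" "v \<in> pverts G"
  shows "dist u v = dist v u"
  using assms by (meson antisym dist_le_relpow sym_relpow[OF sym_parcs] dist_relpow)

lemma dist_triangle:
  assumes "u \<in> pverts G" "v \<in> pverts G" "w \<in> pverts G"
  shows "dist u w \<le> dist u v + dist v w"
  using assms by (intro dist_le_relpow) (auto simp: relpow_add intro: dist_relpow)

lemma dist_self [simp]: "u \<in> pverts G \<Longrightarrow> dist u u = 0"
  using dist_le_relpow[of u u 0] by simp

lemma dist_eq_0_iff: "u \<in> pverts G \<Longrightarrow> v \<in> pverts G \<Longrightarrow> dist u v = 0 \<longleftrightarrow> u = v"
  using dist_relpow[of u v] by auto

lemma dist_eq_1_iff: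
  assumes "u \<in> pverts G" "v \<in> pverts G"
  shows "dist u v = 1 \<longleftrightarrow> (u, v) \<in> parcs G"
proof
  assume "dist u v = 1" with dist_relpow[OF assms] show "(u, v) \<in> parcs G" by simp
next
  assume *: "(u, v) \<in> parcs G"
  with pair_no_loops have "u \<noteq> v" by fastforce
  with assms have "dist u v \<noteq> 0" by (simp add: dist_eq_0_iff)
  moreover have "dist u v \<le> 1" using assms * by (intro dist_le_relpow) auto
  ultimately show "dist u v = 1" by simp
qed

lemma finite_dists: "finite {dist u v | u v. u \<in> pverts G \<and> v \<in> pverts G}"
  by (rule finite_subset[of _ "case_prod dist ` (pverts G \<times> pverts G)"])
    (auto simp: pair_finite_verts)

lemma diam_attained: obtains u v where "u \<in> pverts G" "v \<in> pverts G" "dist u v = diam G"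
proof -
  have "diam G \<in> {dist u v | u v. u \<in> pverts G \<and> v \<in> pverts G}"
    unfolding diam_def using pverts_nonempty by (intro Max_in[OF finite_dists]) auto
  with that show thesis by auto
qed

end

text \<open>Each arc of the product moves exactly one coordinate, so a walk projects to two walks
  that share its length between them.\<close>

lemma relpow_cartesian_productD:
  assumes "(x, y) \<in> parcs (G \<box> H) ^^ k"
  shows "\<exists>i j. i + j = k \<and> (fst x, fst y) \<in> parcs G ^^ i \<and> (snd x, snd y) \<in> parcs H ^^ j"
  using assms
proof (induction k arbitrary: y)
  case (Suc k)
  then obtain z where z: "(x, z) \<in> parcs (G \<box> H) ^^ k" "(z, y) \<in> parcs (G \<box> H)" by auto
  then obtain i j where ij: "i + j = k" "(fst x, fst z) \<in> parcs G ^^ i" "(snd x, snd z) \<in> parcs H ^^ j"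
    using Suc.IH by blast
  from z(2) consider "fst z = fst y" "(snd z, snd y) \<in> parcs H"
    | "snd z = snd y" "(fst z, fst y) \<in> parcs G"
    by (auto simp: cartesian_product_def)
  then show ?case
  proof cases
    case 1
    with ij have "i + Suc j = Suc k \<and> (fst x, fst y) \<in> parcs G ^^ i \<and> (snd x, snd y) \<in> parcs H ^^ Suc j"
      by auto
    then show ?thesis by blast
  next
    case 2
    with ij have "Suc i + j = Suc k \<and> (fst x, fst y) \<in> parcs G ^^ Suc i \<and> (snd x, snd y) \<in> parcs H ^^ j"
      by auto
    then show ?thesis by blast
  qed
qed auto

lemma relpow_cartesian_product_fstI:
  assumes "(a, a') \<in> parcs G ^^ i" "b \<in> pverts H"
  shows "((a, b), (a', b)) \<in> parcs (G \<box> H) ^^ i"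
  using assms
proof (induction i arbitrary: a')
  case (Suc i)
  then obtain c where "(a, c) \<in> parcs G ^^ i" "(c, a') \<in> parcs G" by auto
  with Suc have "((a, b), (c, b)) \<in> parcs (G \<box> H) ^^ i" "((c, b), (a', b)) \<in> parcs (G \<box> H)"
    by (auto simp: cartesian_product_def)
  then show ?case by auto
qed auto

lemma relpow_cartesian_product_sndI:
  assumes "(b, b') \<in> parcs H ^^ j" "a \<in> pverts G"
  shows "((a, b), (a, b')) \<in> parcs (G \<box> H) ^^ j"
  using assms
proof (induction j arbitrary: b')
  case (Suc j)
  then obtain c where "(b, c) \<in> parcs H ^^ j" "(c, b') \<in> parcs H" by auto
  with Suc have "((a, b), (a, c)) \<in> parcs (G \<box> H) ^^ j" "((a, c), (a, b')) \<in> parcs (G \<box> H)"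
    by (auto simp: cartesian_product_def)
  then show ?case by auto
qed auto

lemma gdist_cartesian_product:
  assumes "connected_pair_graph G" "connected_pair_graph H"
    and "x \<in> pverts G \<times> pverts H" "y \<in> pverts G \<times> pverts H"
  shows "gdist (G \<box> H) x y = gdist G (fst x) (fst y) + gdist H (snd x) (snd y)"
proof -
  interpret G: connected_pair_graph G by fact
  interpret H: connected_pair_graph H by fact
  interpret GH: pair_wf_digraph "G \<box> H"
    by unfold_locales (auto simp: cartesian_product_def dest: G.wellformed' H.wellformed')
  obtain a b a' b' where xy: "x = (a, b)" "y = (a', b')"
    "a \<in> pverts G" "b \<in> pverts H" "a' \<in> pverts G" "b' \<in> pverts H"
    using assms(3,4) by auto
  have "gdist (G \<box> H) x y = (LEAST k. (x, y) \<in> parcs (G \<box> H) ^^ k)"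
    using assms(3) by (intro GH.gdist_eq_Least_relpow) (simp add: cartesian_product_def)
  also have "\<dots> = gdist G a a' + gdist H b b'"
  proof (rule Least_equality)
    \<comment> \<open>Move from \<open>a\<close> to \<open>a'\<close> in the layer of
      \<open>b\<close>, then from \<open>b\<close> to \<open>b'\<close> in the layer of
      \<open>a'\<close>.\<close>
    show "(x, y) \<in> parcs (G \<box> H) ^^ (gdist G a a' + gdist H b b')"
      using xy relpow_cartesian_product_fstI[OF G.dist_relpow, of a a' b H]
        relpow_cartesian_product_sndI[OF H.dist_relpow, of b b' a' G]
      by (auto simp: relpow_add)
  next
    fix k assume "(x, y) \<in> parcs (G \<box> H) ^^ k"
    then obtain i j where "i + j = k" "(a, a') \<in> parcs G ^^ i" "(b, b') \<in> parcs H ^^ j"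
      using relpow_cartesian_productD xy by fastforce
    with xy G.dist_le_relpow[of a a' i] H.dist_le_relpow[of b b' j]
    show "gdist G a a' + gdist H b b' \<le> k" by linarith
  qed
  finally show ?thesis by (simp add: xy)
qed

lemma diam_cartesian_product_ge:
  assumes "connected_pair_graph G" "connected_pair_graph H"
  shows "diam G + diam H \<le> diam (G \<box> H)"
proof -
  interpret G: connected_pair_graph G by fact
  interpret H: connected_pair_graph H by fact
  obtain a a' b b' where *: "a \<in> pverts G" "a' \<in> pverts G" "gdist G a a' = diam G"
    "b \<in> pverts H" "b' \<in> pverts H" "gdist H b b' = diam H"
    by (metis G.diam_attained H.diam_attained)
  let ?V = "pverts (G \<box> H)" and ?D = "gdist (G \<box> H)"
  have V: "?V = pverts G \<times> pverts H" by (simp add: cartesian_product_def)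
  have "diam G + diam H = ?D (a, b) (a', b')"
    using * by (simp add: gdist_cartesian_product[OF assms])
  also have "\<dots> \<le> diam (G \<box> H)"
    unfolding diam_def
  proof (rule Max_ge)
    have "finite (case_prod ?D ` (?V \<times> ?V))"
      by (simp add: V G.pair_finite_verts H.pair_finite_verts)
    then show "finite {?D u v |u v. u \<in> ?V \<and> v \<in> ?V}"
      by (rule rev_finite_subset) auto
    show "?D (a, b) (a', b') \<in> {?D u v |u v. u \<in> ?V \<and> v \<in> ?V}"
      using * V by blast
  qed
  finally show ?thesis .
qed

section \<open>Weight centers of trees\<close>

context connected_pair_graph
begin

lemma neighbour_towards:
  assumes "u \<in> pverts G" "v \<in> pverts G" "dist u v = Suc n"
  obtains x where "(u, x) \<in> parcs G" "dist x v = n"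
proof -
  obtain x where x: "(u, x) \<in> parcs G" "(x, v) \<in> parcs G ^^ n"
    using dist_relpow[OF assms(1,2)] assms(3) by (metis relpow_Suc_E2)
  then have V: "x \<in> pverts G" by (blast dest: in_arcsD2)
  with x assms have "dist u x = 1" using dist_eq_1_iff by blast
  with dist_triangle[OF assms(1) V assms(2)] assms(3) dist_le_relpow[OF V x(2)] that[OF x(1)]
  show thesis by linarith
qed

end

locale tree_graph = connected_pair_graph +
  assumes acyclic: "\<not> (\<exists>p. cycle p \<and> 3 \<le> length p)"
begin

text \<open>If \<open>z\<close> were no farther from \<open>u\<close> than \<open>y\<close>,
  shortest walks from \<open>x\<close> to \<open>u\<close> and from \<open>u\<close> to
  \<open>z\<close> would both avoid \<open>y\<close>; joined and closed up through \<open>y\<close>,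
  they would produce a cycle.\<close>

lemma nearer_neighbour_unique:
  assumes u: "u \<in> pverts G" and arcs: "(x, y) \<in> parcs G" "(y, z) \<in> parcs G"
    and "x \<noteq> z" and x: "dist x u \<le> dist y u"
  shows "dist y u < dist z u"
proof (rule ccontr)
  assume "\<not> dist y u < dist z u"
  then have z: "dist z u \<le> dist y u" by simp
  have V: "x \<in> pverts G" "y \<in> pverts G" "z \<in> pverts G"
    using arcs by (blast dest: wellformed')+
  have neq: "x \<noteq> y" "y \<noteq> z" using arcs pair_no_loops by fastforce+
  obtain p where p: "awalk x p u" "length p = dist x u" using shortest_awalk[OF V(1) u] .
  obtain q where q: "awalk u q z" "length q = dist u z" using shortest_awalk[OF u V(3)] .
  \<comment> \<open>A visit to \<open>y\<close> leaves a walk between \<open>y\<close> and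
    \<open>u\<close> that is at least as long as the whole shortest walk, so the remaining piece is
    empty and \<open>y\<close> equals \<open>x\<close> or \<open>z\<close>.\<close>
  have y: "y \<notin> set (pawalk_verts x p)" "y \<notin> set (pawalk_verts u q)"
  proof -
    show "y \<notin> set (pawalk_verts x p)"
    proof
      assume "y \<in> set (pawalk_verts x p)"
      then obtain r s where rs: "p = r @ s" "awalk x r y" "awalk y s u"
        using awalk_decomp[OF p(1)] by blast
      with gdist_le_length[OF rs(3)] x p(2) have "r = []" by (cases r) auto
      with rs(2) neq show False by (auto simp: awalk_Nil_iff)
    qed
    show "y \<notin> set (pawalk_verts u q)"
    proof
      assume "y \<in> set (pawalk_verts u q)"
      then obtain r s where rs: "q = r @ s" "awalk u r y" "awalk y s z"
        using awalk_decomp[OF q(1)] by blast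
      with gdist_le_length[OF rs(2)] z q(2) u V have "s = []"
        by (cases s) (auto simp: dist_commute[of _ u])
      with rs(3) neq show False by (auto simp: awalk_Nil_iff)
    qed
  qed
  have pq: "awalk x (p @ q) z" using p(1) q(1) by (rule awalk_appendI)
  \<comment> \<open>Shortcutting to a path adds no vertices, so \<open>y\<close> is still avoided.
    As \<open>x \<noteq> z\<close>, the path has an arc, and the two arcs at \<open>y\<close> bring
    the cycle to length at least 3.\<close>
  let ?r = "awalk_to_apath (p @ q)"
  have r: "awalk x ?r z" "distinct (pawalk_verts x ?r)"
    using apath_awalk_to_apath[OF pq] by (auto simp: apath_def)
  have "y \<notin> set (pawalk_verts x (p @ q))"
    using y p(1) q(1) by (auto simp: set_awalk_verts_append[OF p(1) q(1), simplified])
  moreover have "set (pawalk_verts x ?r) \<subseteq> set (pawalk_verts x (p @ q))"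
    using set_awalk_verts[OF r(1)] set_awalk_verts[OF pq] awalk_to_apath_subset[OF pq] by auto
  ultimately have "y \<notin> set (pawalk_verts x ?r)" by blast
  moreover have "?r \<noteq> []" using r(1) \<open>x \<noteq> z\<close> by (auto simp: awalk_Nil_iff)
  moreover have "awalk y (((y, x) # ?r) @ [(z, y)]) y"
    using r(1) arcs sym_parcs V by (auto simp: awalk_Cons_iff awalk_Nil_iff dest: symD)
  moreover have "pawalk_verts x (?r @ [(z, y)]) = pawalk_verts x ?r @ [y]"
    using awalk_verts_append[of x ?r "[(z, y)]" y] r(1) arcs sym_parcs V
    by (auto simp: awalk_Cons_iff awalk_Nil_iff dest: symD)
  ultimately have "cycle (((y, x) # ?r) @ [(z, y)])" "3 \<le> length (((y, x) # ?r) @ [(z, y)])"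
    using r(2) by (auto simp: cycle_def Suc_le_eq)
  with acyclic show False by blast
qed

text \<open>For each \<open>u\<close>, one of \<open>x\<close>, \<open>z\<close> is farther from
  \<open>u\<close> than \<open>y\<close>, and the other is nearer by at most 1. Summing over
  \<open>u\<close> gives the weak inequality; the term \<open>u = y\<close> makes it strict.\<close>

lemma vertex_weight_strictly_convex:
  assumes arcs: "(x, y) \<in> parcs G" "(y, z) \<in> parcs G" and "x \<noteq> z"
  shows "2 * vertex_weight G y < vertex_weight G x + vertex_weight G z"
proof -
  have V: "x \<in> pverts G" "y \<in> pverts G" "z \<in> pverts G"
    using arcs by (blast dest: wellformed')+
  have edge: "dist x y = 1" "dist y z = 1" using arcs V dist_eq_1_iff by blast+
  have le: "2 * dist u y \<le> dist u x + dist u z" if u: "u \<in> pverts G" for u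
  proof -
    have "dist y u \<le> dist x u + 1" "dist y u \<le> dist z u + 1"
      using dist_triangle[of y x u] dist_triangle[of y z u] u V edge by (auto simp: dist_commute)
    with nearer_neighbour_unique[OF u arcs \<open>x \<noteq> z\<close>] u V show ?thesis
      by (simp add: dist_commute[OF u]) linarith
  qed
  have "(\<Sum>u\<in>pverts G. 2 * dist u y) < (\<Sum>u\<in>pverts G. dist u x + dist u z)"
  proof (rule sum_strict_mono_ex1[OF pair_finite_verts])
    show "\<exists>u\<in>pverts G. 2 * dist u y < dist u x + dist u z"
      using V edge by (intro bexI[of _ y]) (auto simp: dist_commute)
  qed (use le in blast)
  then show ?thesis by (simp add: vertex_weight_def sum.distrib sum_distrib_left)
qed

text \<open>Induction along a shortest walk to \<open>z\<close>: by convexity, a step that does not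
  lower the weight is followed by one that raises it.\<close>

lemma vertex_weight_increasing:
  assumes "(x, y) \<in> parcs G" "vertex_weight G x \<le> vertex_weight G y"
    and "z \<in> pverts G" "dist x z = Suc (dist y z)" "y \<noteq> z"
  shows "vertex_weight G y < vertex_weight G z"
  using assms
proof (induction "dist y z" arbitrary: x y)
  case 0
  then show ?case using in_arcsD2 dist_eq_0_iff by metis
next
  case (Suc n)
  have "y \<in> pverts G" using Suc.prems(1) by (blast dest: in_arcsD2)
  with Suc.prems Suc.hyps(2) obtain y' where y': "(y, y') \<in> parcs G" "dist y' z = n"
    by (metis neighbour_towards)
  \<comment> \<open>The distances of \<open>x\<close> and \<open>y'\<close> to \<open>z\<close>
    differ by 2, so the walk does not turn back.\<close>
  have "x \<noteq> y'" using Suc.prems Suc.hyps(2) y' by auto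
  with vertex_weight_strictly_convex[OF Suc.prems(1) y'(1)] Suc.prems(2)
  have less: "vertex_weight G y < vertex_weight G y'" by linarith
  show ?case
  proof (cases "y' = z")
    case False
    with Suc.hyps y' less Suc.prems have "vertex_weight G y' < vertex_weight G z"
      by (metis less_imp_le)
    with less show ?thesis by simp
  qed (use less in simp)
qed

text \<open>The first step from \<open>c\<close> towards \<open>c'\<close> cannot lower the minimal
  weight. If it stopped short of \<open>c'\<close>, the weight would rise strictly from there to
  \<open>c'\<close>, which is also minimal.\<close>

lemma weight_centers_adjacent:
  assumes c: "c \<in> weight_centers G" "c' \<in> weight_centers G" "c \<noteq> c'"
  shows "dist c c' = 1"
proof -
  have V: "c \<in> pverts G" "c' \<in> pverts G" using c by (auto simp: weight_centers_def)
  then obtain n where n: "dist c c' = Suc n"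
    using c(3) by (metis dist_eq_0_iff not0_implies_Suc)
  then obtain y where y: "(c, y) \<in> parcs G" "dist y c' = n" using neighbour_towards[OF V] by blast
  then have yV: "y \<in> pverts G" by (blast dest: in_arcsD2)
  have "y = c'"
  proof (rule ccontr)
    assume "y \<noteq> c'"
    with c yV V y n have "vertex_weight G y < vertex_weight G c'"
      by (intro vertex_weight_increasing[OF y(1)]) (auto simp: weight_centers_def)
    with c(2) yV show False by (auto simp: weight_centers_def)
  qed
  with y V show ?thesis by (simp add: n)
qed

end

section \<open>Labelings of minimal span\<close>

text \<open>What the counting uses of a tree with two weight centers: \<open>L\<close> is the level,
  \<open>side\<close> tells which center is nearer, and the \<open>of_bool\<close> term pays for the
  edge between the centers.\<close>

locale two_centred =
  fixes V :: "'a set" and dist :: "'a \<Rightarrow> 'a \<Rightarrow> nat" and L :: "'a \<Rightarrow> nat"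
    and side :: "'a \<Rightarrow> bool" and d :: nat
  assumes finite_V: "finite V"
    and dist_le: "u \<in> V \<Longrightarrow> v \<in> V \<Longrightarrow> dist u v \<le> L u + L v + of_bool (side u \<noteq> side v)"
    and dist_self: "u \<in> V \<Longrightarrow> dist u u = 0"
    and centres: "\<exists>c\<in>V. \<exists>c'\<in>V. side c \<and> \<not> side c' \<and> L c = 0 \<and> L c' = 0"
    and diam_attained: "\<exists>u\<in>V. \<exists>v\<in>V. dist u v = d"
begin

text \<open>Apply \<open>dist_le\<close> to a diametral pair. Equality in the resulting bound forces
  both ends to have maximal level and to lie on opposite sides.\<close>

lemma max_level:
  obtains h where "\<And>u. u \<in> V \<Longrightarrow> L u \<le> h" "\<exists>u\<in>V. L u = h" "d \<le> 2 * h + 1"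
    "d = 2 * h + 1 \<Longrightarrow> \<exists>a\<in>V. \<exists>a'\<in>V. side a \<and> \<not> side a' \<and> L a = h \<and> L a' = h"
proof -
  define h where "h = Max (L ` V)"
  have "V \<noteq> {}" using centres by blast
  then have ex: "\<exists>u\<in>V. L u = h" using finite_V Max_in[of "L ` V"] by (fastforce simp: h_def)
  have le: "L u \<le> h" if "u \<in> V" for u using finite_V that by (simp add: h_def)
  obtain u v where uv: "u \<in> V" "v \<in> V" "dist u v = d" using diam_attained by blast
  have d: "d \<le> 2 * h + of_bool (side u \<noteq> side v)"
    using dist_le[OF uv(1,2)] le[OF uv(1)] le[OF uv(2)] uv(3) by linarith
  have "\<exists>a\<in>V. \<exists>a'\<in>V. side a \<and> \<not> side a' \<and> L a = h \<and> L a' = h" if "d = 2 * h + 1"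
  proof -
    have side: "side u \<noteq> side v" using d that by (cases "side u = side v") auto
    then have "L u = h" "L v = h"
      using dist_le[OF uv(1,2)] le[OF uv(1)] le[OF uv(2)] uv(3) that by auto
    with side uv show ?thesis by blast
  qed
  moreover have "d \<le> 2 * h + 1" using d by (simp add: of_bool_def split: if_splits)
  ultimately show thesis using that le ex by blast
qed

end

lemma sum_consecutive:
  fixes g l :: "nat \<Rightarrow> int"
  shows "(\<Sum>i<q. g (Suc i) - g i - c + l i + l (Suc i)) =
    g q - g 0 - int q * c + 2 * (\<Sum>i\<le>q. l i) - l 0 - l q"
  by (induction q) (simp_all add: algebra_simps)

text \<open>\<open>x\<close> lists the vertices by increasing label, whence no absolute value in
  \<open>label\<close>. The final \<open>+ 1\<close> in \<open>span\<close> is the excess over the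
  sum of the smallest conceivable gaps.\<close>

locale extremal_labelling =
  A: two_centred V1 dist1 L1 side1 d1 + B: two_centred V2 dist2 L2 side2 d2
  for V1 :: "'a set" and dist1 L1 side1 d1 and V2 :: "'b set" and dist2 L2 side2 d2 +
  fixes f :: "'a \<times> 'b \<Rightarrow> nat" and x :: "nat \<Rightarrow> 'a \<times> 'b" and q :: nat
  assumes bij: "bij_betw x {..q} (V1 \<times> V2)"
    and label: "i < j \<Longrightarrow> j \<le> q \<Longrightarrow>
      int d1 + int d2 + 1 \<le> int (f (x j)) - int (f (x i))
        + int (dist1 (fst (x i)) (fst (x j))) + int (dist2 (snd (x i)) (snd (x j)))"
    and span: "int (f (x q)) - int (f (x 0)) =
      int q * (int d1 + int d2 - 1) - 2 * (\<Sum>v\<in>V1 \<times> V2. int (L1 (fst v)) + int (L2 (snd v))) + 1"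
begin

abbreviation "d \<equiv> int d1 + int d2"
abbreviation "lev i \<equiv> int (L1 (fst (x i))) + int (L2 (snd (x i)))"
abbreviation "gap i \<equiv> int (f (x (Suc i))) - int (f (x i))"
text \<open>The excess of a gap over the least value the radio condition can allow, which occurs
  when both coordinates change sides.\<close>

abbreviation "slack i \<equiv> gap i - (d - 1) + lev i + lev (Suc i)"
abbreviation "cross1 i j \<equiv> side1 (fst (x i)) \<noteq> side1 (fst (x j))"
abbreviation "cross2 i j \<equiv> side2 (snd (x i)) \<noteq> side2 (snd (x j))"
abbreviation "crossings i j \<equiv> of_bool (cross1 i j) + of_bool (cross2 i j) :: int"

lemma x_in: "i \<le> q \<Longrightarrow> fst (x i) \<in> V1 \<and> snd (x i) \<in> V2"
  using bij_betwE[OF bij] by (auto simp: mem_Times_iff)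

lemma x_surj: "a \<in> V1 \<Longrightarrow> b \<in> V2 \<Longrightarrow> \<exists>i\<le>q. x i = (a, b)"
proof -
  assume "a \<in> V1" "b \<in> V2"
  then have "(a, b) \<in> x ` {..q}" using bij by (simp add: bij_betw_def)
  then show ?thesis by force
qed

lemma label_lower_bound:
  assumes "i < j" "j \<le> q"
  shows "d + 1 \<le> int (f (x j)) - int (f (x i)) + lev i + lev j + crossings i j"
proof -
  have "int (dist1 (fst (x i)) (fst (x j))) + int (dist2 (snd (x i)) (snd (x j)))
      \<le> lev i + lev j + crossings i j"
    using A.dist_le[of "fst (x i)" "fst (x j)"] B.dist_le[of "snd (x i)" "snd (x j)"]
      x_in[of i] x_in[of j] assms by (simp add: of_bool_def split: if_splits)
  with label[OF assms] show ?thesis by linarith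
qed

lemma slack_ge: "i < q \<Longrightarrow> 2 - crossings i (Suc i) \<le> slack i"
  using label_lower_bound[of i "Suc i"] by simp

text \<open>In the telescoped sum every level counts twice except those of the first and last
  vertex. All slacks and these two end levels thus share a budget of 1.\<close>

lemma sum_slack: "(\<Sum>i<q. slack i) + lev 0 + lev q = 1"
proof -
  have "(\<Sum>v\<in>V1 \<times> V2. int (L1 (fst v)) + int (L2 (snd v))) = (\<Sum>i\<le>q. lev i)"
    using sum.reindex_bij_betw[OF bij, of "\<lambda>v. int (L1 (fst v)) + int (L2 (snd v))"] by simp
  with span show ?thesis
    unfolding sum_consecutive[of "\<lambda>i. int (f (x i))" "d - 1" lev q] by simp
qed

lemma exists_transition: "\<exists>t<q. crossings t (Suc t) \<le> 1"
proof (rule ccontr)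
  assume "\<not> ?thesis"
  then have both: "cross1 i (Suc i) \<and> cross2 i (Suc i)" if "i < q" for i
    using that by (force simp: of_bool_def split: if_splits)
  \<comment> \<open>\<open>?par\<close> names the diagonal pair of quarters containing
    \<open>v\<close>. Changing both sides preserves it, yet \<open>(a, b)\<close> and
    \<open>(a, b')\<close> lie in different pairs.\<close>
  let ?par = "\<lambda>v. side1 (fst v) = side2 (snd v)"
  have par: "?par (x i) = ?par (x 0)" if "i \<le> q" for i
    using that
  proof (induction i)
    case (Suc i)
    with both[of i] show ?case by auto
  qed simp
  obtain a b b' where *: "a \<in> V1" "b \<in> V2" "b' \<in> V2" "side2 b" "\<not> side2 b'"
    using A.centres B.centres by metis
  then obtain i j where "i \<le> q" "x i = (a, b)" "j \<le> q" "x j = (a, b')" by (meson x_surj)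
  with par[of i] par[of j] * show False by auto
qed

text \<open>The step \<open>t\<close> has slack at least 1 and exhausts the budget; zero slack
  elsewhere forces both coordinates to cross.\<close>

lemma transition:
  obtains t where "t < q" "slack t = 1" "crossings t (Suc t) = 1" "lev 0 = 0" "lev q = 0"
    "\<And>i. i < q \<Longrightarrow> i \<noteq> t \<Longrightarrow> slack i = 0 \<and> cross1 i (Suc i) \<and> cross2 i (Suc i)"
proof -
  obtain t where t: "t < q" "crossings t (Suc t) \<le> 1" using exists_transition by blast
  have nonneg: "0 \<le> slack i" if "i < q" for i
    using slack_ge[OF that] by (auto simp: of_bool_def split: if_splits)
  have split: "(\<Sum>i<q. slack i) = slack t + (\<Sum>i\<in>{..<q} - {t}. slack i)"
    using t(1) by (simp add: sum.remove)
  have rest: "0 \<le> (\<Sum>i\<in>{..<q} - {t}. slack i)" using nonneg by (intro sum_nonneg) auto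
  have lev: "0 \<le> lev 0" "0 \<le> lev q" by simp_all
  have "1 \<le> slack t" using slack_ge[OF t(1)] t(2) by linarith
  with split rest sum_slack lev
  have *: "slack t = 1" "(\<Sum>i\<in>{..<q} - {t}. slack i) = 0" "lev 0 = 0" "lev q = 0"
    by linarith+
  have zero: "slack i = 0" if "i < q" "i \<noteq> t" for i
    using *(2) nonneg that by (subst (asm) sum_nonneg_eq_0_iff) auto
  have "cross1 i (Suc i) \<and> cross2 i (Suc i)" if "i < q" "i \<noteq> t" for i
    using slack_ge[OF that(1)] zero[OF that] by (auto simp: of_bool_def split: if_splits)
  moreover have "crossings t (Suc t) = 1" using slack_ge[OF t(1)] *(1) t(2) by linarith
  ultimately show thesis using that t(1) * zero by blast
qed

lemma levels_zero: "u \<in> V1 \<Longrightarrow> v \<in> V2 \<Longrightarrow> L1 u = 0 \<and> L2 v = 0"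
proof -
  obtain t where t: "t < q" "slack t = 1" "crossings t (Suc t) = 1"
    and ends: "lev 0 = 0" "lev q = 0"
    and tight: "\<And>i. i < q \<Longrightarrow> i \<noteq> t \<Longrightarrow> slack i = 0 \<and> cross1 i (Suc i) \<and> cross2 i (Suc i)"
    by (rule transition) (rule that)
  obtain h where h: "\<And>u. u \<in> V1 \<Longrightarrow> L1 u \<le> h" "\<exists>u\<in>V1. L1 u = h" "d1 \<le> 2 * h + 1"
    "d1 = 2 * h + 1 \<Longrightarrow> \<exists>a\<in>V1. \<exists>a'\<in>V1. side1 a \<and> \<not> side1 a' \<and> L1 a = h \<and> L1 a' = h"
    by (rule A.max_level) (rule that)
  obtain k where k: "\<And>u. u \<in> V2 \<Longrightarrow> L2 u \<le> k" "\<exists>u\<in>V2. L2 u = k" "d2 \<le> 2 * k + 1"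
    "d2 = 2 * k + 1 \<Longrightarrow> \<exists>b\<in>V2. \<exists>b'\<in>V2. side2 b \<and> \<not> side2 b' \<and> L2 b = k \<and> L2 b' = k"
    by (rule B.max_level) (rule that)
  \<comment> \<open>Two tight steps return to the same quarter, so there are no crossings between
    \<open>i\<close> and \<open>i + 2\<close>, while the two gaps add up to
    \<open>2 * (d - 1)\<close> minus the levels.\<close>
  have interior: "2 * lev (Suc i) \<le> d - 3" if "Suc (Suc i) \<le> q" "i \<noteq> t" "Suc i \<noteq> t" for i
    using label_lower_bound[of i "Suc (Suc i)"] tight[of i] tight[of "Suc i"] that by auto
  \<comment> \<open>With the step \<open>t\<close> involved, the slack and the single net crossing
    each add 1 to the bound.\<close>
  have near: "2 * lev (Suc i) \<le> d - 1" if "Suc (Suc i) \<le> q" "i = t \<or> Suc i = t" for i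
  proof -
    from that have "gap i + gap (Suc i) = 2 * (d - 1) + 1 - lev i - 2 * lev (Suc i) - lev (Suc (Suc i))"
      using tight[of i] tight[of "Suc i"] t by auto
    moreover have "crossings i (Suc (Suc i)) = 1"
      using that tight[of i] tight[of "Suc i"] t by (auto simp: of_bool_def split: if_splits)
    ultimately show ?thesis using label_lower_bound[of i "Suc (Suc i)"] that by auto
  qed
  have "h + k = 0"
  proof (rule ccontr)
    assume pos: "h + k \<noteq> 0"
    \<comment> \<open>A positive level keeps \<open>j\<close> away from both ends, and
      \<open>d \<le> 2 * (h + k) + 2\<close> contradicts \<open>interior\<close>.\<close>
    have top: "(j = t \<or> j = Suc t) \<and> 2 * (h + k) + 1 \<le> d1 + d2"
      if j: "j \<le> q" "x j = (a, b)" "L1 a = h" "L2 b = k" for j a b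
    proof -
      have lev: "lev j = int (h + k)" using j by simp
      with pos have "lev j \<noteq> 0" by linarith
      with ends have "j \<noteq> 0" "j \<noteq> q" by metis+
      then obtain i where i: "j = Suc i" "Suc (Suc i) \<le> q"
        using j(1) by (metis Suc_leI le_neq_implies_less not0_implies_Suc)
      have "j = t \<or> j = Suc t"
        using interior[OF i(2)] i(1) lev h(3) k(3) by fastforce
      with near[OF i(2)] i(1) lev show ?thesis by auto
    qed
    have place: "\<exists>j. (j = t \<or> j = Suc t) \<and> x j = (a, b)"
      if "a \<in> V1" "b \<in> V2" "L1 a = h" "L2 b = k" for a b
      using x_surj[OF that(1,2)] top that(3,4) by metis
    have at_most_two: "\<not> distinct [u, v, w]"
      if "fst u \<in> V1" "snd u \<in> V2" "L1 (fst u) = h" "L2 (snd u) = k"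
        "fst v \<in> V1" "snd v \<in> V2" "L1 (fst v) = h" "L2 (snd v) = k"
        "fst w \<in> V1" "snd w \<in> V2" "L1 (fst w) = h" "L2 (snd w) = k" for u v w
      using place[of "fst u" "snd u"] place[of "fst v" "snd v"] place[of "fst w" "snd w"] that by auto
    \<comment> \<open>The exact distances are kept: for equal coordinates they vanish, whereas the
      bound through the centers would give twice the level.\<close>
    have lab_t: "d + 1 \<le> gap t + int (dist1 (fst (x t)) (fst (x (Suc t))))
        + int (dist2 (snd (x t)) (snd (x (Suc t))))"
      using label[of t "Suc t"] t by simp
    obtain a b where ab: "a \<in> V1" "L1 a = h" "b \<in> V2" "L2 b = k" using h(2) k(2) by blast
    then have "2 * (h + k) + 1 \<le> d1 + d2" using top x_surj[of a b] by metis
    \<comment> \<open>One diameter attains its bound, so that tree has vertices of maximal level on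
      both sides.\<close>
    then have "d1 = 2 * h + 1 \<or> d2 = 2 * k + 1" using h(3) k(3) by arith
    then consider "d1 = 2 * h + 1" | "d2 = 2 * k + 1" by blast
    then show False
    proof cases
      case 1
      then obtain a0 a1 where a: "a0 \<in> V1" "a1 \<in> V1" "side1 a0" "\<not> side1 a1" "L1 a0 = h" "L1 a1 = h"
        using h(4) by blast
      with ab place[of a0 b] place[of a1 b]
      have xt: "x t = (a0, b) \<and> x (Suc t) = (a1, b) \<or> x t = (a1, b) \<and> x (Suc t) = (a0, b)" by auto
      then have "gap t = d - lev t - lev (Suc t)" "lev t = int (h + k)" "lev (Suc t) = int (h + k)"
        using t a ab by auto
      moreover have "dist1 (fst (x t)) (fst (x (Suc t))) \<le> 2 * h + 1"
        using xt A.dist_le[of a0 a1] A.dist_le[of a1 a0] a by auto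
      moreover have "dist2 (snd (x t)) (snd (x (Suc t))) = 0" using xt ab B.dist_self by auto
      \<comment> \<open>The condition reads
        \<open>d + 1 \<le> d - 2 * (h + k) + (2 * h + 1)\<close>. With \<open>k = 0\<close> both
        centers of the second tree have maximal level, which yields a third top vertex.\<close>
      ultimately have "k = 0" using lab_t by linarith
      obtain c c' where "c \<in> V2" "c' \<in> V2" "side2 c" "\<not> side2 c'" "L2 c = 0" "L2 c' = 0"
        using B.centres by blast
      with a \<open>k = 0\<close> at_most_two[of "(a0, c)" "(a1, c)" "(a0, c')"] show False by auto
    next
      case 2
      then obtain b0 b1 where b: "b0 \<in> V2" "b1 \<in> V2" "side2 b0" "\<not> side2 b1" "L2 b0 = k" "L2 b1 = k"
        using k(4) by blast
      with ab place[of a b0] place[of a b1]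
      have xt: "x t = (a, b0) \<and> x (Suc t) = (a, b1) \<or> x t = (a, b1) \<and> x (Suc t) = (a, b0)" by auto
      then have "gap t = d - lev t - lev (Suc t)" "lev t = int (h + k)" "lev (Suc t) = int (h + k)"
        using t b ab by auto
      moreover have "dist2 (snd (x t)) (snd (x (Suc t))) \<le> 2 * k + 1"
        using xt B.dist_le[of b0 b1] B.dist_le[of b1 b0] b by auto
      moreover have "dist1 (fst (x t)) (fst (x (Suc t))) = 0" using xt ab A.dist_self by auto
      ultimately have "h = 0" using lab_t by linarith
      obtain c c' where "c \<in> V1" "c' \<in> V1" "side1 c" "\<not> side1 c'" "L1 c = 0" "L1 c' = 0"
        using A.centres by blast
      with b \<open>h = 0\<close> at_most_two[of "(c, b0)" "(c, b1)" "(c', b0)"] show False by auto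
    qed
  qed
  then show "u \<in> V1 \<Longrightarrow> v \<in> V2 \<Longrightarrow> L1 u = 0 \<and> L2 v = 0" using h(1) k(1) by fastforce
qed

end

section \<open>Trees with two weight centers\<close>

context tree_graph
begin

lemma two_weight_centers:
  assumes "card (weight_centers G) = 2"
  obtains c c' where "c \<in> pverts G" "c' \<in> pverts G" "dist c c' = 1"
    "\<And>u. vertex_level G u = min (dist u c) (dist u c')"
proof -
  obtain c c' where W: "weight_centers G = {c, c'}" and neq: "c \<noteq> c'"
    using assms by (auto simp: card_2_iff)
  moreover have "c \<in> pverts G" "c' \<in> pverts G" using W by (auto simp: weight_centers_def)
  moreover have "dist c c' = 1" using W neq by (intro weight_centers_adjacent) auto
  moreover have "vertex_level G u = min (dist u c) (dist u c')" for u
    by (simp add: vertex_level_def W)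
  ultimately show thesis using that by blast
qed

text \<open>Route \<open>u\<close> to \<open>v\<close> through the center nearer to each; the edge
  between the centers is used only when these differ.\<close>

lemma two_centred_tree:
  assumes "card (weight_centers G) = 2"
  shows "\<exists>side. two_centred (pverts G) dist (vertex_level G) side (diam G)"
proof -
  obtain c c' where c: "c \<in> pverts G" "c' \<in> pverts G" "dist c c' = 1"
    and level: "\<And>u. vertex_level G u = min (dist u c) (dist u c')"
    by (rule two_weight_centers[OF assms]) (rule that)
  let ?side = "\<lambda>u. dist u c \<le> dist u c'"
  have c': "dist c' c = 1" using c by (simp add: dist_commute[of c'])
  have "two_centred (pverts G) dist (vertex_level G) ?side (diam G)"
  proof
    fix u v assume uv: "u \<in> pverts G" "v \<in> pverts G"
    have "dist u v \<le> dist u c + dist v c" "dist u v \<le> dist u c' + dist v c'"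
      using dist_triangle[of u c v] dist_triangle[of u c' v] uv c
      by (simp_all add: dist_commute)
    moreover have "dist u v \<le> dist u c + 1 + dist v c'" "dist u v \<le> dist u c' + 1 + dist v c"
      using dist_triangle[of u c v] dist_triangle[of u c' v]
        dist_triangle[of c c' v] dist_triangle[of c' c v] uv c c'
      by (simp_all add: dist_commute[of v])
    ultimately show "dist u v \<le> vertex_level G u + vertex_level G v + of_bool (?side u \<noteq> ?side v)"
      unfolding level by (cases "?side u"; cases "?side v") auto
  next
    show "\<exists>a\<in>pverts G. \<exists>b\<in>pverts G. ?side a \<and> \<not> ?side b \<and> vertex_level G a = 0 \<and> vertex_level G b = 0"
      using c c' by (intro bexI[of _ c] bexI[of _ c']) (auto simp: level)
  next
    show "\<exists>u\<in>pverts G. \<exists>v\<in>pverts G. dist u v = diam G" by (meson diam_attained)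
  qed (simp_all add: pair_finite_verts)
  then show ?thesis by blast
qed

text \<open>Level 0 means being a center, so the tree consists of two adjacent vertices.\<close>

lemma digraph_iso_path_graph_2:
  assumes "card (weight_centers G) = 2" and zero: "\<And>u. u \<in> pverts G \<Longrightarrow> vertex_level G u = 0"
  shows "digraph_iso (with_proj G) (with_proj (path_graph 2))"
proof -
  obtain c c' where c: "c \<in> pverts G" "c' \<in> pverts G" "dist c c' = 1"
    and level: "\<And>u. vertex_level G u = min (dist u c) (dist u c')"
    by (rule two_weight_centers[OF assms(1)]) (rule that)
  have neq: "c \<noteq> c'" using c by auto
  have V: "pverts G = {c, c'}"
  proof
    show "pverts G \<subseteq> {c, c'}"
    proof
      fix u assume u: "u \<in> pverts G"
      then have "dist u c = 0 \<or> dist u c' = 0"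
        using zero[OF u] level[of u] by (auto simp: min_def split: if_splits)
      with u c show "u \<in> {c, c'}" by (auto simp: dist_eq_0_iff)
    qed
  qed (use c in blast)
  have "(c, c') \<in> parcs G" using c dist_eq_1_iff by blast
  then have E: "parcs G = {(c, c'), (c', c)}"
    using V sym_parcs pair_no_loops by (fastforce dest: symD wellformed')
  define g where "g v = (if v = c then 0 else 1 :: nat)" for v
  define hom where "hom = \<lparr>iso_verts = g, iso_arcs = map_prod g g,
    iso_head = (snd :: nat \<times> nat \<Rightarrow> nat), iso_tail = fst\<rparr>"
  have "digraph_isomorphism hom"
    using neq unfolding digraph_isomorphism_def
    by (auto simp: hom_def g_def V E inj_on_def intro: wf_digraph)
  moreover have "with_proj (path_graph 2) = app_iso hom (with_proj G)"
    using neq by (auto simp: with_proj_def path_graph_def app_iso_def hom_def g_def V E)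
  ultimately show ?thesis by (auto simp: digraph_iso_def)
qed

end

section \<open>Optimal labelings and the conclusion for the product\<close>

lemma tree_graphI:
  assumes "undirected_tree T"
  shows "tree_graph T"
proof -
  interpret pair_graph T using assms by (simp add: undirected_tree_def)
  show ?thesis using assms by unfold_locales (auto simp: undirected_tree_def)
qed

lemma radio_number_attained:
  assumes "finite (pverts G)"
  obtains f where "radio_labeling G f" "label_span G f = radio_number G"
proof -
  obtain e :: "'a \<Rightarrow> nat" where e: "inj_on e (pverts G)"
    using assms by (meson finite_imp_inj_to_nat_seg)
  \<comment> \<open>Distinct multiples of \<open>diam G + 1\<close> satisfy every radio condition,
    so the \<open>LEAST\<close> in \<open>radio_number\<close> ranges over a nonempty set.\<close>
  have "radio_labeling G (\<lambda>v. e v * (diam G + 1))"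
    unfolding radio_labeling_def
  proof (intro ballI impI)
    fix u v assume "u \<in> pverts G" "v \<in> pverts G" "u \<noteq> v"
    with e have "e u \<noteq> e v" by (simp add: inj_on_eq_iff)
    then have "1 \<le> \<bar>int (e u) - int (e v)\<bar>" by linarith
    then have "1 * int (diam G + 1) \<le> \<bar>int (e u) - int (e v)\<bar> * int (diam G + 1)"
      by (intro mult_right_mono) auto
    also have "\<dots> = \<bar>int (e u * (diam G + 1)) - int (e v * (diam G + 1))\<bar>"
      by (simp only: of_nat_mult left_diff_distrib[symmetric] abs_mult abs_of_nat)
    finally show "int (diam G) + 1 - int (gdist G u v)
        \<le> \<bar>int (e u * (diam G + 1)) - int (e v * (diam G + 1))\<bar>" by simp
  qed
  then have "\<exists>k f. radio_labeling G f \<and> label_span G f = k" by blast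
  then have "\<exists>f. radio_labeling G f \<and> label_span G f = radio_number G"
    unfolding radio_number_def by (rule LeastI_ex)
  with that show thesis by blast
qed

theorem theorem3p2:
  fixes T1 :: "'a pair_pre_digraph" and T2 :: "'b pair_pre_digraph"
    and G :: "('a \<times> 'b) pair_pre_digraph"
    and m n d1 d2 p d :: nat
  assumes "undirected_tree T1" and "undirected_tree T2"
    and "card (pverts T1) = m" and "card (pverts T2) = n"
    and "diam T1 = d1" and "diam T2 = d2"
    and "card (weight_centers T1) = 2" and "card (weight_centers T2) = 2"
    and "G = T1 \<box> T2" and "p = m * n" and "d = d1 + d2"
    and "int (radio_number G) =
           (int p - 1) * (int d - 1) - 2 * int n * int (total_level T1)
             - 2 * int m * int (total_level T2) + 1"
  shows "digraph_iso (with_proj T1) (with_proj (path_graph 2)) \<and>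
         digraph_iso (with_proj T2) (with_proj (path_graph 2))"
proof -
  interpret T1: tree_graph T1 using assms(1) by (rule tree_graphI)
  interpret T2: tree_graph T2 using assms(2) by (rule tree_graphI)
  have conn: "connected_pair_graph T1" "connected_pair_graph T2" by unfold_locales
  obtain side1 side2
    where two1: "two_centred (pverts T1) (gdist T1) (vertex_level T1) side1 d1"
      and two2: "two_centred (pverts T2) (gdist T2) (vertex_level T2) side2 d2"
    using T1.two_centred_tree T2.two_centred_tree assms(5-8) by metis
  have V: "pverts G = pverts T1 \<times> pverts T2" by (simp add: assms(9) cartesian_product_def)
  then have fin: "finite (pverts G)" by (simp add: T1.pair_finite_verts T2.pair_finite_verts)
  obtain f where f: "radio_labeling G f" "label_span G f = radio_number G"
    using radio_number_attained[OF fin] .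
  obtain ys where "set ys = pverts G" "distinct ys" using finite_distinct_list[OF fin] by blast
  then obtain xs where xs: "set xs = pverts G" "distinct xs" "sorted (map f xs)"
    by (metis set_sort distinct_sort sorted_sort_key)
  have len: "length xs = p" using xs distinct_card[of xs] V assms by (simp add: card_cartesian_product)
  have "xs \<noteq> []" using xs(1) V T1.pverts_nonempty T2.pverts_nonempty by auto
  then obtain q where q: "p = Suc q" using len by (cases p) auto
  have idx: "{..q} = {..<length xs}" using len q by auto
  have mono: "f (xs ! i) \<le> f (xs ! j)" if "i \<le> j" "j \<le> q" for i j
    using sorted_nth_mono[OF xs(3), of i j] that len q by simp
  have mem: "xs ! i \<in> pverts G" if "i \<le> q" for i using nth_mem[of i xs] xs(1) that len q by simp
  have bij: "bij_betw ((!) xs) {..q} (pverts G)"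
    using xs idx by (intro bij_betw_nth) auto
  have img: "f ` pverts G = (\<lambda>i. f (xs ! i)) ` {..q}"
    unfolding bij_betw_imp_surj_on[OF bij, symmetric] by (simp only: image_image)
  have "Max (f ` pverts G) = f (xs ! q)"
    unfolding img by (rule Max_eqI) (auto intro: mono)
  moreover have "Min (f ` pverts G) = f (xs ! 0)"
    unfolding img by (rule Min_eqI) (auto intro: mono)
  ultimately have spn: "int (f (xs ! q)) - int (f (xs ! 0)) = int (radio_number G)"
    using f(2) mono[of 0 q] by (simp add: label_span_def of_nat_diff)
  \<comment> \<open>Each vertex of \<open>T1\<close> occurs in \<open>n\<close> pairs and each
    vertex of \<open>T2\<close> in \<open>m\<close> pairs.\<close>
  have levels: "(\<Sum>v\<in>pverts T1 \<times> pverts T2. int (vertex_level T1 (fst v)) + int (vertex_level T2 (snd v)))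
      = int n * int (total_level T1) + int m * int (total_level T2)"
    using assms(3,4)
    by (simp add: sum.cartesian_product' sum.distrib total_level_def sum_distrib_left)
  interpret extremal_labelling "pverts T1" "gdist T1" "vertex_level T1" side1 d1
    "pverts T2" "gdist T2" "vertex_level T2" side2 d2 f "\<lambda>i. xs ! i" q
  proof (intro extremal_labelling.intro two1 two2 extremal_labelling_axioms.intro)
    show "bij_betw ((!) xs) {..q} (pverts T1 \<times> pverts T2)"
      using bij by (simp only: V)
  next
    fix i j assume ij: "i < j" "j \<le> q"
    have "xs ! i \<noteq> xs ! j" using ij len q xs(2) by (simp add: nth_eq_iff_index_eq)
    with f(1) mem[of i] mem[of j] ij
    have "int (diam G) + 1 - int (gdist G (xs ! i) (xs ! j)) \<le> \<bar>int (f (xs ! i)) - int (f (xs ! j))\<bar>"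
      by (auto simp: radio_labeling_def)
    moreover have "f (xs ! i) \<le> f (xs ! j)" using mono[of i j] ij by simp
    \<comment> \<open>A larger diameter only strengthens the radio condition, so this inequality
      lets \<open>d1 + d2\<close> replace \<open>diam G\<close>.\<close>
    moreover have "d1 + d2 \<le> diam G"
      using diam_cartesian_product_ge[OF conn] assms(5,6,9) by simp
    moreover have "gdist G (xs ! i) (xs ! j) =
        gdist T1 (fst (xs ! i)) (fst (xs ! j)) + gdist T2 (snd (xs ! i)) (snd (xs ! j))"
      using gdist_cartesian_product[OF conn] mem[of i] mem[of j] ij V assms(9) by simp
    ultimately show "int d1 + int d2 + 1 \<le> int (f (xs ! j)) - int (f (xs ! i))
        + int (gdist T1 (fst (xs ! i)) (fst (xs ! j)))
        + int (gdist T2 (snd (xs ! i)) (snd (xs ! j)))" by linarith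
  next
    show "int (f (xs ! q)) - int (f (xs ! 0)) = int q * (int d1 + int d2 - 1)
        - 2 * (\<Sum>v\<in>pverts T1 \<times> pverts T2. int (vertex_level T1 (fst v)) + int (vertex_level T2 (snd v))) + 1"
      unfolding levels spn assms(12) using q assms(11) by (simp add: algebra_simps)
  qed
  have "vertex_level T1 u = 0" if "u \<in> pverts T1" for u
    using levels_zero that T2.pverts_nonempty by blast
  moreover have "vertex_level T2 v = 0" if "v \<in> pverts T2" for v
    using levels_zero that T1.pverts_nonempty by blast
  ultimately show ?thesis
    using T1.digraph_iso_path_graph_2 T2.digraph_iso_path_graph_2 assms(7,8) by blast
qed

end
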